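(* Let $n\ge1$. With commuting indeterminates $x_1,\dots,x_n,s,t$, $$\sum_{\sigma\in B_n}(-1)^{\mathrm{cyc}(\sigma)}s^{\mathrm{neg}(\sigma)}t^{\mathrm{nsum}(\sigma)}\prod_{i\in\mathrm{EXC_B}(\sigma)}x_i=-\Bigl(1+(-1)^{n-1}x_ns^nt^{\frac{n(n+1)}{2}}\Bigr)\prod_{j=1}^{n-1}(x_j-1).$$
   Context: $B_n$ is the set of permutations $\sigma$ of $\{\pm1,\dots,\pm n\}$ with $\sigma(-i)=-\sigma(i)$ for all $i\in[n]$, identified with the word $\sigma(1)\cdots\sigma(n)$; $|\sigma|$ denotes the permutation $i\mapsto|\sigma(i)|$ of $[n]$, and $\mathrm{cyc}(\sigma)$ is the number of cycles of $|\sigma|$. $\mathrm{Neg}(\sigma)=\{i\in[n]:\sigma(i)<0\}$, $\mathrm{neg}(\sigma)=\#\mathrm{Neg}(\sigma)$, $\mathrm{nsum}(\sigma)=\sum_{i\in\mathrm{Neg}(\sigma)}|\sigma(i)|$. The set of type B excedances is $\mathrm{EXC_B}(\sigma)=\{|\sigma(i)|:i\in[n],\ \sigma(|\sigma(i)|)=-|\sigma(i)|\text{ or }\sigma(|\sigma(i)|)>\sigma(i)\}$. *)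

theory Defs
  imports "HOL-Combinatorics.Orbits" "HOL-Library.Poly_Mapping"
begin

text \<open>
  Letters of \<open>[n]\<close> are naturals, signed letters are integers. An element of \<open>B\<^sub>n\<close> is a function
  on all of \<open>int\<close>, which \<open>permutes\<close> makes the identity off \<open>{\<plusminus>1, \<dots>, \<plusminus>n}\<close>; thus each signed
  permutation is represented exactly once.
\<close>

definition signed_perms :: "nat \<Rightarrow> (int \<Rightarrow> int) set" where
  "signed_perms n =
     {\<sigma>. \<sigma> permutes ({- int n..int n} - {0}) \<and> (\<forall>i\<in>{1..n}. \<sigma> (- int i) = - \<sigma> (int i))}"

definition abs_perm :: "(int \<Rightarrow> int) \<Rightarrow> nat \<Rightarrow> nat" where
  "abs_perm \<sigma> i = nat \<bar>\<sigma> (int i)\<bar>"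

text \<open>Cycles are counted as orbits, so fixed points of \<open>|\<sigma>|\<close> in \<open>[n]\<close> count as cycles.\<close>

definition cyc :: "nat \<Rightarrow> (int \<Rightarrow> int) \<Rightarrow> nat" where
  "cyc n \<sigma> = card (orbit (abs_perm \<sigma>) ` {1..n})"

definition Neg :: "nat \<Rightarrow> (int \<Rightarrow> int) \<Rightarrow> nat set" where
  "Neg n \<sigma> = {i \<in> {1..n}. \<sigma> (int i) < 0}"

definition neg :: "nat \<Rightarrow> (int \<Rightarrow> int) \<Rightarrow> nat" where
  "neg n \<sigma> = card (Neg n \<sigma>)"

definition nsum :: "nat \<Rightarrow> (int \<Rightarrow> int) \<Rightarrow> nat" where
  "nsum n \<sigma> = (\<Sum>i\<in>Neg n \<sigma>. nat \<bar>\<sigma> (int i)\<bar>)"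

definition EXC_B :: "nat \<Rightarrow> (int \<Rightarrow> int) \<Rightarrow> nat set" where
  "EXC_B n \<sigma> =
     {nat \<bar>\<sigma> (int i)\<bar> | i. i \<in> {1..n} \<and>
        (\<sigma> \<bar>\<sigma> (int i)\<bar> = - \<bar>\<sigma> (int i)\<bar> \<or> \<sigma> \<bar>\<sigma> (int i)\<bar> > \<sigma> (int i))}"

text \<open>
  Integer polynomials in the indeterminates \<open>x\<^sub>i\<close> (\<open>i\<close> natural), \<open>s\<close> and \<open>t\<close>: finitely supported
  maps from monomials (exponent vectors) to coefficients, with convolution as the product.
\<close>

datatype indet = X_indet nat | S_indet | T_indet

type_synonym polynomial = "(indet \<Rightarrow>\<^sub>0 nat) \<Rightarrow>\<^sub>0 int"

definition indet_poly :: "indet \<Rightarrow> polynomial" where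
  "indet_poly v = Poly_Mapping.single (Poly_Mapping.single v 1) 1"

abbreviation x_var :: "nat \<Rightarrow> polynomial" where
  "x_var i \<equiv> indet_poly (X_indet i)"

abbreviation s_var :: polynomial where
  "s_var \<equiv> indet_poly S_indet"

abbreviation t_var :: polynomial where
  "t_var \<equiv> indet_poly T_indet"

end

theory Submission
  imports Defs
begin

text \<open>
  Encode \<open>\<sigma>\<close> by \<open>\<tau> = |\<sigma>|\<close> and the set \<open>S\<close> of absolute values of its negative letters. As
  \<open>(-1)\<^bsup>cyc \<sigma>\<^esup> = (-1)\<^sup>n sign \<tau>\<close>, the terms belonging to a fixed \<open>S\<close> add up to a determinant, whose
  \<open>(v, u)\<close> entry is \<open>x\<^sub>v\<close> if \<open>u\<close> follows \<open>v\<close> in the order in which the letters of \<open>S\<close> are negated,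
  or if \<open>u = v \<in> S\<close>, and is \<open>1\<close> otherwise. If \<open>S\<close> and its complement in \<open>[n]\<close> are both nonempty,
  the columns of their least elements, which are neighbours in that order, coincide and the
  determinant vanishes. For \<open>S = {}\<close> and \<open>S = [n]\<close> the entry depends on \<open>v\<close> and on whether
  \<open>u \<le> v\<close> only, and subtracting adjacent columns evaluates the determinant.
\<close>

section \<open>The sign of a permutation and its number of cycles\<close>

lemma permutes_self_in_orbit:
  assumes "p permutes A" "finite A"
  shows "x \<in> orbit p x"
  using assms permutation_permutes permutation_self_in_orbit by metis

lemma orbit_eqI_permutes:
  assumes "p permutes A" "finite A" "y \<in> orbit p x"
  shows "orbit p y = orbit p x"
proof
  show "orbit p y \<subseteq> orbit p x"
    using assms(3) by (auto intro: orbit_trans)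
  have "x \<in> orbit p y"
    using orbit_swap permutes_self_in_orbit[OF assms(1,2)] assms(3) by metis
  then show "orbit p x \<subseteq> orbit p y"
    by (auto intro: orbit_trans)
qed

text \<open>Composing with the transposition splices \<open>a\<close> out of its cycle: the
  predecessor of \<open>a\<close> goes straight to \<open>p a\<close>, and \<open>a\<close> ends up
  fixed.\<close>

lemma orbit_transpose_comp:
  assumes "p permutes insert a A" "finite A" "a \<notin> A" "x \<in> A"
  shows "orbit (transpose a (p a) \<circ> p) x = orbit p x - {a}"
proof -
  define q where "q = transpose a (p a) \<circ> p"
  have q: "q permutes A"
    unfolding q_def by (rule permutes_insert_lemma[OF assms(1)])
  have q_eq: "q y = (if p y = a then p a else p y)" if "y \<noteq> a" for y
    using that permutes_inj[OF assms(1)] unfolding q_def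
    by (auto simp: transpose_def dest: injD)
  \<comment> \<open>The walk along \<open>p\<close> may land on \<open>a\<close>, which the walk
    along \<open>q\<close> skips; there the invariant records the next point \<open>p a\<close>
    instead.\<close>
  have fwd: "(y = a \<longrightarrow> p a = a \<or> p a \<in> orbit q x) \<and> (y \<noteq> a \<longrightarrow> y \<in> orbit q x)"
    if "y \<in> orbit p x" for y
    using that
  proof induction
    case base
    have "x \<noteq> a"
      using assms(3,4) by auto
    then show ?case
      using q_eq[of x] orbit.base[of q x] by (auto split: if_splits)
  next
    case (step y)
    then show ?case
      using q_eq[of y] orbit.step[of y q x] by (cases "y = a") (auto split: if_splits)
  qed
  have "y \<in> orbit p x" if "y \<in> orbit q x" for y
    using that
  proof induction
    case base
    have "x \<noteq> a"
      using assms(3,4) by auto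
    then show ?case
      using q_eq[of x] orbit.base[of p x] orbit.step[of a p x] by (auto split: if_splits)
  next
    case (step y)
    have "y \<noteq> a"
      using step(1) permutes_orbit_subset[OF q assms(4)] assms(3) by auto
    then show ?case
      using q_eq[of y] orbit.step[OF step(2)] orbit.step[of a p x] by (auto split: if_splits)
  qed
  moreover have "a \<notin> orbit q x"
    using permutes_orbit_subset[OF q assms(4)] assms(3) by auto
  ultimately show ?thesis
    using fwd unfolding q_def by auto
qed

text \<open>Induction by splicing out \<open>a\<close>. A fixed \<open>a\<close> takes one orbit
  with it and keeps the sign; any other \<open>a\<close> keeps the number of orbits and flips the
  sign. Either change matches the loss of one factor from \<open>(-1) ^ card A\<close>.\<close>

lemma sign_orbits:
  assumes "finite A" "p permutes A"
  shows "(-1) ^ card (orbit p ` A) = (-1) ^ card A * sign p"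
  using assms
proof (induction A arbitrary: p rule: finite_induct)
  case empty
  then show ?case by simp
next
  case (insert a A)
  define q where "q = transpose a (p a) \<circ> p"
  have q: "q permutes A"
    unfolding q_def by (rule permutes_insert_lemma[OF insert.prems])
  have fin: "finite (insert a A)"
    using insert.hyps by simp
  have self: "x \<in> orbit p x" for x
    by (rule permutes_self_in_orbit[OF insert.prems fin])
  \<comment> \<open>Each of these orbits contains a point of \<open>A\<close>, which survives the
    removal of \<open>a\<close> and still identifies the orbit.\<close>
  have inj: "inj_on (\<lambda>C. C - {a}) (orbit p ` A)"
  proof (rule inj_onI, clarify)
    fix x y assume "x \<in> A" "y \<in> A" "orbit p x - {a} = orbit p y - {a}"
    then have "x \<in> orbit p y"
      using self[of x] insert.hyps by blast
    then show "orbit p x = orbit p y"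
      by (rule orbit_eqI_permutes[OF insert.prems fin])
  qed
  have "orbit q ` A = (\<lambda>C. C - {a}) ` orbit p ` A"
    unfolding image_image q_def
    using orbit_transpose_comp[OF insert.prems insert.hyps(1,2)] by (rule image_cong[OF refl])
  then have card_q: "card (orbit q ` A) = card (orbit p ` A)"
    using card_image[OF inj] by simp
  have p_eq: "p = transpose a (p a) \<circ> q"
    by (simp add: q_def fun_eq_iff)
  have "permutation q"
    using q insert.hyps(1) permutation_permutes by metis
  then have "sign (transpose a (p a) \<circ> q) = sign (transpose a (p a)) * sign q"
    by (rule sign_compose[OF permutation_swap_id])
  then have "sign p = sign (transpose a (p a)) * sign q"
    by (simp only: p_eq[symmetric])
  then have sign_p: "sign p = (if p a = a then sign q else - sign q)"
    by (simp add: sign_swap_id)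
  show ?case
  proof (cases "p a = a")
    case True
    then have "orbit p a = {a}"
      by (simp add: orbit_eq_singleton_iff)
    moreover have "{a} \<notin> orbit p ` A"
    proof
      assume "{a} \<in> orbit p ` A"
      then obtain x where "x \<in> A" "orbit p x = {a}" by auto
      then show False
        using self[of x] insert.hyps by simp
    qed
    ultimately have "card (orbit p ` insert a A) = Suc (card (orbit p ` A))"
      using insert.hyps by simp
    then show ?thesis
      using insert.IH[OF q] card_q sign_p True insert.hyps by simp
  next
    case False
    then have "p a \<in> A"
      using permutes_in_image[OF insert.prems, of a] by auto
    moreover have "orbit p (p a) = orbit p a"
      by (rule orbit_eqI_permutes[OF insert.prems fin orbit.base])
    ultimately have "orbit p a \<in> orbit p ` A"
      by (metis imageI)
    then have "orbit p ` insert a A = orbit p ` A"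
      by (simp add: insert_absorb)
    then show ?thesis
      using insert.IH[OF q] card_q sign_p False insert.hyps by simp
  qed
qed

section \<open>Determinants over a finite index set\<close>

text \<open>The Leibniz formula over an index set instead of numbered rows, so that deleting an
  index changes only the set and not \<open>M\<close>.\<close>

definition det_on :: "'a set \<Rightarrow> ('a \<Rightarrow> 'a \<Rightarrow> 'b::comm_ring_1) \<Rightarrow> 'b" where
  "det_on A M = (\<Sum>p | p permutes A. of_int (sign p) * (\<Prod>v\<in>A. M v (p v)))"

lemma sign_transpose_comp:
  assumes "finite A" "p permutes A" "c \<noteq> d"
  shows "sign (transpose c d \<circ> p) = - sign p"
  using assms permutation_permutes
  by (subst sign_compose) (auto simp: permutation_swap_id sign_swap_id)

lemma transpose_comp_permutes_iff:
  assumes "c \<in> A" "d \<in> A"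
  shows "transpose c d \<circ> p permutes A \<longleftrightarrow> p permutes A"
proof
  have tr: "transpose c d permutes A"
    using assms by (rule permutes_swap_id)
  show "p permutes A" if "transpose c d \<circ> p permutes A"
    using permutes_compose[OF that tr] by (simp add: comp_assoc[symmetric])
  show "transpose c d \<circ> p permutes A" if "p permutes A"
    using permutes_compose[OF that tr] .
qed

text \<open>Swapping \<open>c\<close> and \<open>d\<close> keeps the product and reverses the sign.
  Even permutations are matched with odd ones because \<open>2 * det_on A M = 0\<close> would not
  suffice in an arbitrary commutative ring.\<close>

lemma det_on_equal_columns:
  assumes "finite A" "c \<in> A" "d \<in> A" "c \<noteq> d" and col: "\<And>v. v \<in> A \<Longrightarrow> M v c = M v d"
  shows "det_on A M = 0"
proof -
  define f where "f p = of_int (sign p) * (\<Prod>v\<in>A. M v (p v))" for p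
  let ?t = "\<lambda>p. transpose c d \<circ> p"
  have f_t: "f (?t p) = - f p" if "p permutes A" for p
  proof -
    have "M v (transpose c d u) = M v u" if "v \<in> A" for v u
      using col[OF that] by (auto simp: transpose_def)
    then show ?thesis
      using sign_transpose_comp[OF assms(1) that assms(4)] by (simp add: f_def)
  qed
  have even_t: "evenperm (?t p) \<longleftrightarrow> \<not> evenperm p" if "p permutes A" for p
    using sign_transpose_comp[OF assms(1) that assms(4)] by (auto simp: sign_def split: if_splits)
  have "(\<Sum>p | p permutes A \<and> \<not> evenperm p. f p) = (\<Sum>p | p permutes A \<and> evenperm p. f (?t p))"
    by (rule sum.reindex_bij_witness[where i = ?t and j = ?t])
      (auto simp: even_t transpose_comp_permutes_iff assms(2,3) comp_assoc[symmetric])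
  also have "\<dots> = - (\<Sum>p | p permutes A \<and> evenperm p. f p)"
    by (simp add: f_t sum_negf)
  finally have "(\<Sum>p | p permutes A \<and> evenperm p. f p) + (\<Sum>p | p permutes A \<and> \<not> evenperm p. f p) = 0"
    by simp
  moreover have "det_on A M
      = (\<Sum>p | p permutes A \<and> evenperm p. f p) + (\<Sum>p | p permutes A \<and> \<not> evenperm p. f p)"
    unfolding det_on_def f_def[symmetric]
    by (subst sum.union_disjoint[symmetric])
      (auto simp: finite_permutations[OF assms(1)] intro!: sum.cong)
  ultimately show ?thesis by simp
qed

text \<open>Subtract column \<open>c\<close> from column \<open>d\<close> and expand along column \<open>d\<close>.\<close>

lemma det_on_almost_equal_columns:
  assumes "finite A" "c \<in> A" "d \<in> A" "c \<noteq> d"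
    and col: "\<And>v. v \<in> A - {c} \<Longrightarrow> M v c = M v d"
  shows "det_on A M = (M c c - M c d) * det_on (A - {c}) M"
proof -
  \<comment> \<open>Column \<open>d\<close> is overwritten by column \<open>c\<close>, so the
    determinant of \<open>M'\<close> vanishes and subtracting it amounts to the column
    operation.\<close>
  define M' where "M' v u = M v (if u = d then c else u)" for v u
  define R where "R p = (\<Prod>v\<in>A - {c}. M v (p v))" for p
  let ?t = "\<lambda>p. transpose c d \<circ> p"
  have R_t: "R (?t p) = R p" for p
    unfolding R_def using col by (intro prod.cong) (auto simp: transpose_def)
  have prod_M: "(\<Prod>v\<in>A. M v (p v)) = M c (p c) * R p" for p
    unfolding R_def using assms(1,2) by (simp add: prod.remove)
  have prod_M': "(\<Prod>v\<in>A. M' v (p v)) = M c (if p c = d then c else p c) * R p" for p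
  proof -
    have "M' v u = M v u" if "v \<in> A - {c}" for v u
      using col[OF that] by (simp add: M'_def)
    then show ?thesis
      unfolding R_def prod.remove[OF assms(1,2)] by (simp add: M'_def)
  qed
  have "det_on A M' = 0"
    using assms(1-4) by (rule det_on_equal_columns) (use assms(4) in \<open>simp add: M'_def\<close>)
  then have "det_on A M = det_on A M - det_on A M'"
    by simp
  also have "\<dots> = (\<Sum>p | p permutes A. of_int (sign p) *
      (M c (p c) - M c (if p c = d then c else p c)) * R p)"
    unfolding det_on_def prod_M prod_M' sum_subtractf[symmetric]
    by (simp add: algebra_simps)
  also have "\<dots> = (\<Sum>p | p permutes A \<and> p c = d. of_int (sign p) * (M c d - M c c) * R p)"
    by (rule sum.mono_neutral_cong_right) (auto simp: finite_permutations[OF assms(1)])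
  \<comment> \<open>The surviving minor lacks row \<open>c\<close> and column \<open>d\<close>. Its
    column \<open>c\<close> may be renamed \<open>d\<close>, since the two agree in the remaining
    rows; the renaming costs a sign.\<close>
  also have "\<dots> = (\<Sum>p | p permutes A - {c}. of_int (sign (?t p)) * (M c d - M c c) * R (?t p))"
  proof (rule sum.reindex_bij_witness[where i = ?t and j = ?t])
    fix p assume "p \<in> {p. p permutes A \<and> p c = d}"
    then have p: "p permutes A" and "p c = d" by auto
    have "insert c (A - {c}) = A"
      using assms(2) by auto
    then show "?t p \<in> {p. p permutes A - {c}}"
      using permutes_insert_lemma[of p c "A - {c}"] p \<open>p c = d\<close> by simp
  next
    fix p assume "p \<in> {p. p permutes A - {c}}"
    then have "p permutes A" "p c = c"
      by (auto intro: permutes_subset simp: permutes_not_in)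
    then show "?t p \<in> {p. p permutes A \<and> p c = d}"
      using assms(2,3) by (simp add: transpose_comp_permutes_iff)
  qed (auto simp: comp_assoc[symmetric])
  also have "\<dots> = (\<Sum>p | p permutes A - {c}. (M c c - M c d) * (of_int (sign p) * R p))"
  proof (rule sum.cong[OF refl], clarify)
    fix p assume "p permutes A - {c}"
    then have "p permutes A"
      by (auto intro: permutes_subset)
    then show "of_int (sign (?t p)) * (M c d - M c c) * R (?t p)
        = (M c c - M c d) * (of_int (sign p) * R p)"
      unfolding R_t using sign_transpose_comp[OF assms(1) _ assms(4), of p]
      by (simp add: algebra_simps)
  qed
  also have "\<dots> = (M c c - M c d) * det_on (A - {c}) M"
    by (simp add: det_on_def R_def sum_distrib_left)
  finally show ?thesis .
qed

text \<open>If \<open>d\<close> is the successor in \<open>A\<close> of a non-maximal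
  \<open>c\<close>, columns \<open>c\<close> and \<open>d\<close> differ only in row
  \<open>c\<close>, by \<open>a c - b c\<close>. Removing such indices one at a time leaves the
  single entry \<open>a (Max A)\<close>.\<close>

lemma det_on_step_rows:
  fixes a b :: "'a::linorder \<Rightarrow> 'b::comm_ring_1"
  assumes "finite A" "A \<noteq> {}"
  shows "det_on A (\<lambda>v u. if u \<le> v then a v else b v)
    = a (Max A) * (\<Prod>v\<in>A - {Max A}. a v - b v)"
  using assms
proof (induction "card A" arbitrary: A rule: less_induct)
  case less
  let ?M = "\<lambda>v u. if u \<le> v then a v else b v"
  show ?case
  proof (cases "A = {Max A}")
    case True
    then obtain m where "A = {m}" by blast
    then show ?thesis
      by (simp add: det_on_def)
  next
    case False
    then obtain c where c: "c \<in> A" "c \<noteq> Max A"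
      using less.prems by blast
    then have "c < Max A"
      using less.prems by (simp add: order_less_le)
    define d where "d = Min {u \<in> A. c < u}"
    have "Max A \<in> {u \<in> A. c < u}"
      using less.prems \<open>c < Max A\<close> by simp
    then have "d \<in> {u \<in> A. c < u}"
      unfolding d_def using less.prems by (intro Min_in) (simp, metis empty_iff)
    then have d: "d \<in> A" "c < d" "\<not> d \<le> c" by auto
    have d_le: "d \<le> v" if "v \<in> A" "c < v" for v
      unfolding d_def using that less.prems by (intro Min_le) auto
    have Max_eq: "Max (A - {c}) = Max A"
      using less.prems c by (intro Max_eqI) auto
    have nonempty: "A - {c} \<noteq> {}"
      using d by auto
    have "det_on A ?M = (?M c c - ?M c d) * det_on (A - {c}) ?M"
    proof (rule det_on_almost_equal_columns)
      fix v assume "v \<in> A - {c}"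
      then show "?M v c = ?M v d"
        using d d_le[of v] by (auto simp: order_less_le)
    qed (use less.prems c d in auto)
    also have "\<dots> = (a c - b c) * (a (Max A) * (\<Prod>v\<in>A - {c} - {Max A}. a v - b v))"
      using less.hyps[of "A - {c}"] less.prems c d nonempty
      by (simp add: Max_eq card_Diff1_less card_gt_0_iff)
    also have "\<dots> = a (Max A) * (\<Prod>v\<in>A - {Max A}. a v - b v)"
    proof -
      have "A - {c} - {Max A} = A - {Max A} - {c}" by auto
      moreover have "(\<Prod>v\<in>A - {Max A}. a v - b v)
          = (a c - b c) * (\<Prod>v\<in>A - {Max A} - {c}. a v - b v)"
        using less.prems c by (intro prod.remove) auto
      ultimately show ?thesis
        by (simp only: mult.left_commute)
    qed
    finally show ?thesis .
  qed
qed

section \<open>Signed permutations as permutations with a set of negative values\<close>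

definition letter :: "nat set \<Rightarrow> nat \<Rightarrow> int" where
  "letter S v = (if v \<in> S then - int v else int v)"

text \<open>The factor \<open>sgn z\<close> makes the function odd and sends 0 to 0.
  \<open>S\<close> collects values, not positions, so that the letter of absolute value
  \<open>v\<close> has a sign independent of \<open>\<tau>\<close>.\<close>

definition signed_perm :: "nat set \<Rightarrow> (nat \<Rightarrow> nat) \<Rightarrow> int \<Rightarrow> int" where
  "signed_perm S \<tau> z = sgn z * letter S (\<tau> (nat \<bar>z\<bar>))"

definition neg_values :: "nat \<Rightarrow> (int \<Rightarrow> int) \<Rightarrow> nat set" where
  "neg_values n \<sigma> = abs_perm \<sigma> ` Neg n \<sigma>"

lemma abs_letter [simp]: "\<bar>letter S v\<bar> = int v"
  by (simp add: letter_def)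

lemma letter_eq_0_iff [simp]: "letter S v = 0 \<longleftrightarrow> v = 0"
  by (simp add: letter_def)

lemma abs_signed_perm: "z \<noteq> 0 \<Longrightarrow> \<bar>signed_perm S \<tau> z\<bar> = int (\<tau> (nat \<bar>z\<bar>))"
  by (simp add: signed_perm_def abs_mult)

lemma signed_perm_pos: "0 < i \<Longrightarrow> signed_perm S \<tau> (int i) = letter S (\<tau> i)"
  by (simp add: signed_perm_def)

lemma signed_perm_minus: "signed_perm S \<tau> (- z) = - signed_perm S \<tau> z"
  by (simp add: signed_perm_def sgn_minus)

lemma abs_perm_signed_perm:
  assumes "\<tau> permutes {1..n}"
  shows "abs_perm (signed_perm S \<tau>) = \<tau>"
proof
  fix i
  have "\<tau> 0 = 0"
    using permutes_not_in[OF assms, of 0] by simp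
  then show "abs_perm (signed_perm S \<tau>) i = \<tau> i"
    by (cases "i = 0") (auto simp: abs_perm_def abs_signed_perm signed_perm_def)
qed

lemma Neg_signed_perm:
  assumes "\<tau> permutes {1..n}"
  shows "Neg n (signed_perm S \<tau>) = {i \<in> {1..n}. \<tau> i \<in> S}"
proof -
  have "0 < \<tau> i" if "i \<in> {1..n}" for i
    using permutes_in_image[OF assms, of i] that by auto
  then show ?thesis
    by (auto simp: Neg_def signed_perm_pos letter_def split: if_splits)
qed

lemma bij_betw_Neg_signed_perm:
  assumes "\<tau> permutes {1..n}" "S \<subseteq> {1..n}"
  shows "bij_betw \<tau> (Neg n (signed_perm S \<tau>)) S"
  unfolding bij_betw_def Neg_signed_perm[OF assms(1)]
proof
  show "inj_on \<tau> {i \<in> {1..n}. \<tau> i \<in> S}"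
    by (rule permutes_inj_on[OF assms(1)])
  show "\<tau> ` {i \<in> {1..n}. \<tau> i \<in> S} = S"
  proof
    show "S \<subseteq> \<tau> ` {i \<in> {1..n}. \<tau> i \<in> S}"
    proof
      fix v assume "v \<in> S"
      moreover from this obtain i where "i \<in> {1..n}" "v = \<tau> i"
        using permutes_image[OF assms(1)] assms(2) by (metis imageE subsetD)
      ultimately show "v \<in> \<tau> ` {i \<in> {1..n}. \<tau> i \<in> S}" by simp
    qed
  qed auto
qed

lemma neg_values_signed_perm:
  assumes "\<tau> permutes {1..n}" "S \<subseteq> {1..n}"
  shows "neg_values n (signed_perm S \<tau>) = S"
  using bij_betw_Neg_signed_perm[OF assms] abs_perm_signed_perm[OF assms(1)]
  by (simp add: neg_values_def bij_betw_def)

lemma signed_perm_in_signed_perms: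
  assumes "\<tau> permutes {1..n}" "S \<subseteq> {1..n}"
  shows "signed_perm S \<tau> \<in> signed_perms n"
proof -
  let ?A = "{- int n..int n} - {0}"
  have "inj_on (signed_perm S \<tau>) ?A"
  proof (rule inj_onI)
    fix y z assume yz: "y \<in> ?A" "z \<in> ?A" and eq: "signed_perm S \<tau> y = signed_perm S \<tau> z"
    then have "\<tau> (nat \<bar>y\<bar>) = \<tau> (nat \<bar>z\<bar>)"
      using abs_signed_perm[of y S \<tau>] abs_signed_perm[of z S \<tau>] by simp
    then have nat_eq: "nat \<bar>y\<bar> = nat \<bar>z\<bar>"
      using permutes_inj[OF assms(1)] by (simp add: inj_eq)
    have "\<tau> (nat \<bar>z\<bar>) \<noteq> 0"
      using permutes_in_image[OF assms(1), of "nat \<bar>z\<bar>"] yz by auto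
    then have "sgn y = sgn z"
      using eq nat_eq by (simp add: signed_perm_def)
    moreover have "\<bar>y\<bar> = \<bar>z\<bar>"
      using nat_eq by (simp add: nat_eq_iff)
    ultimately show "y = z"
      by (metis sgn_mult_abs)
  qed
  moreover have "signed_perm S \<tau> ` ?A \<subseteq> ?A"
  proof (rule image_subsetI)
    fix z assume "z \<in> ?A"
    then have "\<tau> (nat \<bar>z\<bar>) \<in> {1..n}"
      using permutes_in_image[OF assms(1), of "nat \<bar>z\<bar>"] by auto
    then have "0 < \<bar>signed_perm S \<tau> z\<bar>" "\<bar>signed_perm S \<tau> z\<bar> \<le> int n"
      using \<open>z \<in> ?A\<close> abs_signed_perm[of z S \<tau>] by auto
    then show "signed_perm S \<tau> z \<in> ?A" by auto
  qed
  ultimately have "bij_betw (signed_perm S \<tau>) ?A ?A"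
    by (simp add: bij_betw_def endo_inj_surj)
  moreover have "signed_perm S \<tau> z = z" if "z \<notin> ?A" for z
  proof -
    have "nat \<bar>z\<bar> \<notin> {1..n}"
      using that by auto
    then have "\<tau> (nat \<bar>z\<bar>) = nat \<bar>z\<bar>" "nat \<bar>z\<bar> \<notin> S"
      using permutes_not_in[OF assms(1)] assms(2) by auto
    then show ?thesis
      by (simp add: signed_perm_def letter_def sgn_mult_abs)
  qed
  ultimately have "signed_perm S \<tau> permutes ?A"
    by (rule bij_imp_permutes)
  then show ?thesis
    by (simp add: signed_perms_def signed_perm_minus)
qed

text \<open>Oddness is postulated on \<open>[n]\<close> only. It passes to the negative letters by
  substitution, and elsewhere the permutation is the identity.\<close>

lemma signed_perms_minus:
  assumes "\<sigma> \<in> signed_perms n"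
  shows "\<sigma> (- z) = - \<sigma> z"
proof -
  let ?A = "{- int n..int n} - {0}"
  have perm: "\<sigma> permutes ?A" and odd: "\<And>i. i \<in> {1..n} \<Longrightarrow> \<sigma> (- int i) = - \<sigma> (int i)"
    using assms by (auto simp: signed_perms_def)
  show ?thesis
  proof (cases "z \<in> ?A")
    case True
    then have "nat \<bar>z\<bar> \<in> {1..n}" by auto
    then show ?thesis
      using odd[of "nat \<bar>z\<bar>"] by (cases "z < 0") auto
  next
    case False
    moreover have "- z \<notin> ?A"
      using False by auto
    ultimately show ?thesis
      using permutes_not_in[OF perm] by metis
  qed
qed

lemma abs_perm_permutes:
  assumes "\<sigma> \<in> signed_perms n"
  shows "abs_perm \<sigma> permutes {1..n}"
proof (rule bij_imp_permutes)
  let ?A = "{- int n..int n} - {0}"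
  have perm: "\<sigma> permutes ?A"
    using assms by (simp add: signed_perms_def)
  have "inj_on (abs_perm \<sigma>) {1..n}"
  proof (rule inj_onI)
    fix i j assume ij: "i \<in> {1..n}" "j \<in> {1..n}" "abs_perm \<sigma> i = abs_perm \<sigma> j"
    \<comment> \<open>Equal absolute values mean equality up to sign, and oddness moves that sign
      into the argument.\<close>
    then have "\<sigma> (int i) = \<sigma> (int j) \<or> \<sigma> (int i) = \<sigma> (- int j)"
      unfolding abs_perm_def signed_perms_minus[OF assms] by linarith
    then have "int i = int j \<or> int i = - int j"
      using permutes_inj[OF perm] by (simp add: inj_eq)
    then show "i = j"
      using ij by auto
  qed
  moreover have "abs_perm \<sigma> ` {1..n} \<subseteq> {1..n}"
  proof (rule image_subsetI)
    fix i assume "i \<in> {1..n}"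
    then have "\<sigma> (int i) \<in> ?A"
      using permutes_in_image[OF perm, of "int i"] by auto
    then show "abs_perm \<sigma> i \<in> {1..n}"
      by (auto simp: abs_perm_def)
  qed
  ultimately show "bij_betw (abs_perm \<sigma>) {1..n} {1..n}"
    by (simp add: bij_betw_def endo_inj_surj)
  show "abs_perm \<sigma> i = i" if "i \<notin> {1..n}" for i
    using permutes_not_in[OF perm, of "int i"] that by (auto simp: abs_perm_def)
qed

lemma neg_values_subset:
  assumes "\<sigma> \<in> signed_perms n"
  shows "neg_values n \<sigma> \<subseteq> {1..n}"
  using permutes_image[OF abs_perm_permutes[OF assms]] by (auto simp: neg_values_def Neg_def)

lemma signed_perm_neg_values:
  assumes "\<sigma> \<in> signed_perms n"
  shows "signed_perm (neg_values n \<sigma>) (abs_perm \<sigma>) = \<sigma>"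
proof -
  have perm: "\<sigma> permutes {- int n..int n} - {0}"
    using assms by (simp add: signed_perms_def)
  have pos: "signed_perm (neg_values n \<sigma>) (abs_perm \<sigma>) (int i) = \<sigma> (int i)" for i
  proof (cases "i = 0")
    case True
    then show ?thesis
      using permutes_not_in[OF perm, of 0] by (simp add: signed_perm_def)
  next
    case False
    \<comment> \<open>By injectivity a value is negated exactly when the position carrying it
      is.\<close>
    have "abs_perm \<sigma> i \<in> neg_values n \<sigma> \<longleftrightarrow> i \<in> Neg n \<sigma>"
      using permutes_inj[OF abs_perm_permutes[OF assms]]
      by (simp add: neg_values_def inj_image_mem_iff)
    also have "\<dots> \<longleftrightarrow> \<sigma> (int i) < 0"
      using permutes_not_in[OF perm, of "int i"] by (auto simp: Neg_def) fastforce+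
    finally show ?thesis
      using False by (auto simp: signed_perm_pos letter_def abs_perm_def)
  qed
  show ?thesis
  proof
    fix z
    show "signed_perm (neg_values n \<sigma>) (abs_perm \<sigma>) z = \<sigma> z"
      by (cases z rule: int_cases2)
        (simp_all only: pos signed_perm_minus signed_perms_minus[OF assms])
  qed
qed

lemma sum_signed_perms:
  "(\<Sum>\<sigma>\<in>signed_perms n. f \<sigma>)
    = (\<Sum>S\<in>Pow {1..n}. \<Sum>\<tau> | \<tau> permutes {1..n}. f (signed_perm S \<tau>))"
  unfolding sum.cartesian_product
  by (rule sum.reindex_bij_witness[where j = "\<lambda>\<sigma>. (neg_values n \<sigma>, abs_perm \<sigma>)"
        and i = "\<lambda>(S, \<tau>). signed_perm S \<tau>"])
    (auto simp: signed_perm_neg_values neg_values_signed_perm abs_perm_signed_perm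
      abs_perm_permutes[simplified] signed_perm_in_signed_perms
      dest: subsetD[OF neg_values_subset])

definition exc_at :: "nat set \<Rightarrow> nat \<Rightarrow> nat \<Rightarrow> bool" where
  "exc_at S v u \<longleftrightarrow> u = v \<and> v \<in> S \<or> letter S v < letter S u"

text \<open>For \<open>v = \<tau> i\<close> the letter at position \<open>i\<close> is
  \<open>letter S v\<close>, whatever \<open>i\<close> is, and the letter at position
  \<open>v\<close> is \<open>letter S (\<tau> v)\<close>. Hence only \<open>v\<close> and
  \<open>\<tau> v\<close> matter, and the weight is a product of matrix entries.\<close>

lemma EXC_B_signed_perm:
  assumes "\<tau> permutes {1..n}"
  shows "EXC_B n (signed_perm S \<tau>) = {v \<in> {1..n}. exc_at S v (\<tau> v)}"
proof -
  let ?P = "\<lambda>v. signed_perm S \<tau> (int v) = - int v \<or> signed_perm S \<tau> (int v) > letter S v"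
  have "EXC_B n (signed_perm S \<tau>) = {\<tau> i | i. i \<in> {1..n} \<and> ?P (\<tau> i)}"
    unfolding EXC_B_def by (intro Collect_cong ex_cong1) (auto simp: signed_perm_pos)
  also have "\<dots> = {v \<in> \<tau> ` {1..n}. ?P v}"
    by blast
  also have "\<dots> = {v \<in> {1..n}. ?P v}"
    by (simp only: permutes_image[OF assms])
  also have "\<dots> = {v \<in> {1..n}. exc_at S v (\<tau> v)}"
    by (auto simp: signed_perm_pos exc_at_def letter_def split: if_splits)
  finally show ?thesis .
qed

section \<open>Summation over the signed permutations with given negative values\<close>

definition exc_entry :: "nat set \<Rightarrow> nat \<Rightarrow> nat \<Rightarrow> polynomial" where
  "exc_entry S v u = (if exc_at S v u then x_var v else 1)"

lemma sum_fixed_neg_values: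
  assumes "S \<subseteq> {1..n}"
  shows "(\<Sum>\<tau> | \<tau> permutes {1..n}. let \<sigma> = signed_perm S \<tau> in
      (-1) ^ cyc n \<sigma> * s_var ^ neg n \<sigma> * t_var ^ nsum n \<sigma> * (\<Prod>i\<in>EXC_B n \<sigma>. x_var i))
    = (-1) ^ n * s_var ^ card S * t_var ^ \<Sum>S * det_on {1..n} (exc_entry S)"
  unfolding det_on_def sum_distrib_left
proof (rule sum.cong[OF refl], clarify)
  fix \<tau> assume \<tau>: "\<tau> permutes {1..n}"
  let ?\<sigma> = "signed_perm S \<tau>"
  have "(-1) ^ cyc n ?\<sigma> = (-1) ^ n * sign \<tau>"
    using sign_orbits[OF _ \<tau>] by (simp add: cyc_def abs_perm_signed_perm[OF \<tau>])
  then have "of_int ((-1) ^ cyc n ?\<sigma>) = (of_int ((-1) ^ n * sign \<tau>) :: polynomial)"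
    by (rule arg_cong)
  then have cyc: "(-1) ^ cyc n ?\<sigma> = ((-1) ^ n * of_int (sign \<tau>) :: polynomial)"
    by simp
  have neg: "neg n ?\<sigma> = card S"
    unfolding neg_def by (rule bij_betw_same_card[OF bij_betw_Neg_signed_perm[OF \<tau> assms]])
  have "nsum n ?\<sigma> = (\<Sum>i\<in>Neg n ?\<sigma>. \<tau> i)"
    unfolding nsum_def by (rule sum.cong[OF refl]) (auto simp: Neg_def signed_perm_pos)
  also have "\<dots> = \<Sum>S"
    by (rule sum.reindex_bij_betw[OF bij_betw_Neg_signed_perm[OF \<tau> assms]])
  finally have nsum: "nsum n ?\<sigma> = \<Sum>S" .
  have exc: "(\<Prod>i\<in>EXC_B n ?\<sigma>. x_var i) = (\<Prod>v\<in>{1..n}. exc_entry S v (\<tau> v))"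
    unfolding EXC_B_signed_perm[OF \<tau>] exc_entry_def
    by (rule prod.inter_filter) simp
  show "(let \<sigma> = ?\<sigma> in (-1) ^ cyc n \<sigma> * s_var ^ neg n \<sigma> * t_var ^ nsum n \<sigma>
      * (\<Prod>i\<in>EXC_B n \<sigma>. x_var i))
    = (-1) ^ n * s_var ^ card S * t_var ^ \<Sum>S
      * (of_int (sign \<tau>) * (\<Prod>v\<in>{1..n}. exc_entry S v (\<tau> v)))"
    unfolding Let_def cyc neg nsum exc by (simp add: algebra_simps)
qed

section \<open>Evaluation of the determinants\<close>

lemma det_on_exc_entry_mixed:
  assumes "S \<subseteq> {1..n}" "S \<noteq> {}" "S \<noteq> {1..n}"
  shows "det_on {1..n} (exc_entry S) = 0"
proof -
  define c where "c = Min S"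
  define d where "d = Min ({1..n} - S)"
  have "finite S"
    using assms(1) finite_subset by blast
  then have c: "c \<in> S" "\<And>v. v \<in> S \<Longrightarrow> c \<le> v"
    using assms(2) by (auto simp: c_def)
  have "{1..n} - S \<noteq> {}"
    using assms by blast
  then have d: "d \<in> {1..n} - S" "\<And>v. v \<in> {1..n} - S \<Longrightarrow> d \<le> v"
    unfolding d_def by (rule Min_in[rotated], simp) (rule Min_le, auto)
  show ?thesis
  proof (rule det_on_equal_columns)
    fix v assume "v \<in> {1..n}"
    \<comment> \<open>The letters \<open>- c\<close> and \<open>d\<close> are the largest negative
      and the least positive one. Both columns have \<open>x_var v\<close> in the rows
      \<open>v\<close> of \<open>S\<close> and 1 in all others; at \<open>v = c\<close>, column
      \<open>c\<close> relies on the clause \<open>u = v\<close>.\<close>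
    then show "exc_entry S v c = exc_entry S v d"
      using c(1) c(2)[of v] d(1) d(2)[of v]
      by (cases "v \<in> S") (auto simp: exc_entry_def exc_at_def letter_def)
  qed (use assms c d in auto)
qed

lemma det_on_exc_entry_empty:
  assumes "n \<ge> 1"
  shows "det_on {1..n} (exc_entry {}) = (\<Prod>j=1..n - 1. 1 - x_var j)"
proof -
  have "exc_entry {} = (\<lambda>v u. if u \<le> v then 1 else x_var v)"
    by (auto simp: fun_eq_iff exc_entry_def exc_at_def letter_def)
  moreover have "Max {1..n} = n" "{1..n} - {n} = {1..n - 1}"
    using assms by (auto intro: Max_eqI)
  ultimately show ?thesis
    using det_on_step_rows[of "{1..n}" "\<lambda>_. 1" x_var] assms by simp
qed

text \<open>Negating every letter reverses the order, and the clause for \<open>u = v\<close> adds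
  the diagonal, so the excedance condition becomes \<open>u \<le> v\<close>.\<close>

lemma det_on_exc_entry_full:
  assumes "n \<ge> 1"
  shows "det_on {1..n} (exc_entry {1..n}) = x_var n * (\<Prod>j=1..n - 1. x_var j - 1)"
proof -
  \<comment> \<open>The two matrices agree only on columns in \<open>[n]\<close>: a letter beyond
    \<open>n\<close> is not negated and exceeds every \<open>- v\<close>. The comparison is
    therefore made inside the sum.\<close>
  have "det_on {1..n} (exc_entry {1..n}) = det_on {1..n} (\<lambda>v u. if u \<le> v then x_var v else 1)"
    unfolding det_on_def
  proof (intro sum.cong refl arg_cong2[where f = times] prod.cong)
    fix p v assume "p \<in> {p. p permutes {1..n}}" "v \<in> {1..n}"
    then have "p v \<in> {1..n}"
      using permutes_in_image[of p "{1..n}" v] by simp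
    with \<open>v \<in> {1..n}\<close> show "exc_entry {1..n} v (p v) = (if p v \<le> v then x_var v else 1)"
      by (auto simp: exc_entry_def exc_at_def letter_def)
  qed
  moreover have "Max {1..n} = n" "{1..n} - {n} = {1..n - 1}"
    using assms by (auto intro: Max_eqI)
  ultimately show ?thesis
    using det_on_step_rows[of "{1..n}" x_var "\<lambda>_. 1"] assms by simp
qed

theorem theorem4p1:
  fixes n :: nat
  assumes "n \<ge> 1"
  shows "(\<Sum>\<sigma>\<in>signed_perms n.
            (-1) ^ cyc n \<sigma> * s_var ^ neg n \<sigma> * t_var ^ nsum n \<sigma> * (\<Prod>i\<in>EXC_B n \<sigma>. x_var i))
         = - (1 + (-1) ^ (n - 1) * x_var n * s_var ^ n * t_var ^ (n * (n + 1) div 2))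
             * (\<Prod>j=1..n - 1. (x_var j - 1))"
proof -
  let ?P = "\<Prod>j=1..n - 1. (x_var j - 1)"
  let ?g = "\<lambda>S. (-1) ^ n * s_var ^ card S * t_var ^ \<Sum>S * det_on {1..n} (exc_entry S)"
  have "(\<Prod>j=1..n - 1. 1 - x_var j) = (\<Prod>j=1..n - 1. (-1) * (x_var j - 1))"
    by simp
  also have "\<dots> = (-1) ^ (n - 1) * ?P"
    unfolding prod.distrib by simp
  finally have flip: "(\<Prod>j=1..n - 1. 1 - x_var j) = (-1) ^ (n - 1) * ?P" .
  have sum_n: "\<Sum>{1..n} = n * (n + 1) div 2"
    using Sum_Icc_nat[of 1 n] by simp
  obtain m where m: "n = Suc m"
    using assms by (cases n) auto
  have "(\<Sum>\<sigma>\<in>signed_perms n.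
      (-1) ^ cyc n \<sigma> * s_var ^ neg n \<sigma> * t_var ^ nsum n \<sigma> * (\<Prod>i\<in>EXC_B n \<sigma>. x_var i))
    = (\<Sum>S\<in>Pow {1..n}. ?g S)"
    unfolding sum_signed_perms
    by (intro sum.cong refl) (use sum_fixed_neg_values[unfolded Let_def] in auto)
  also have "\<dots> = (\<Sum>S\<in>{{}, {1..n}}. ?g S)"
  proof (rule sum.mono_neutral_right)
    show "\<forall>S\<in>Pow {1..n} - {{}, {1..n}}. ?g S = 0"
      using det_on_exc_entry_mixed by auto
  qed auto
  also have "\<dots> = ?g {} + ?g {1..n}"
    using assms by simp
  \<comment> \<open>The empty set contributes \<open>(-1) ^ n * (-1) ^ (n - 1) * ?P\<close>, which
    is \<open>- ?P\<close>; for the full set, \<open>(-1) ^ n\<close> is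
    \<open>- ((-1) ^ (n - 1))\<close>. Writing \<open>n = Suc m\<close> resolves the truncated
    subtraction.\<close>
  also have "\<dots> = - (1 + (-1) ^ (n - 1) * x_var n * s_var ^ n * t_var ^ (n * (n + 1) div 2)) * ?P"
    unfolding det_on_exc_entry_empty[OF assms] det_on_exc_entry_full[OF assms] flip sum_n
    by (simp add: m algebra_simps flip: power_add)
  finally show ?thesis .
qed

end
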